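(* Let $d$ be a positive integer, let $\Gamma$ be a graph on some finite subset $V$ of $\mathbb{N}_0^d$, let $m\in\mathbb{N}^d$ be such that $m>v$ for all $v\in V$, and let $N\in\mathbb{N}^d$. Then for every free measure-preserving action $f$ of $\mathbb{N}_0^d$ on an atomless standard probability space $(X,\mathcal{X},\mu)$, we have \[ \frac{\pi(N)}{\pi(N+m)}\,M_\Gamma(N)\ \le\ d_\Gamma(X,f)\ \le\ M_\Gamma(N)+\sum_{i=1}^d\frac{1}{N(i)}. \]
   Context: $\mathbb{N}$ is the set of positive integers and $\mathbb{N}_0$ the set of non-negative integers. For $k,\ell\in\mathbb{N}_0^d$, $k<\ell$ means $k(j)<\ell(j)$ for every $j\in\{1,\dots,d\}$. For $N\in\mathbb{N}^d$, $\pi(N)=N(1)\cdots N(d)$. A measure-preserving action of $\mathbb{N}_0^d$ on $X$ is a map $f:\mathbb{N}_0^d\times X\to X$ such that for each $n\in\mathbb{N}_0^d$ the map $f_n:X\to X$, $x\mapsto f(n,x)$ is measure-preserving (not necessarily invertible), $f_0$ is the identity map, and $f_{m+n}(x)=f_m(f_n(x))$ for all $m,n\in\mathbb{N}_0^d$, $x\in X$. It is free if $\mu(\{x\in X: f_k(x)=f_\ell(x)\})=0$ for every distinct $k,\ell\in\mathbb{N}_0^d$. Let $\Gamma$ be a graph with vertex set a finite set $V\subset\mathbb{N}_0^d$. A set $A\in\mathcal{X}$ is $\Gamma$-admissible for $f$ if for every edge $uv$ of $\Gamma$ the images satisfy $f_u(A)\cap f_v(A)=\emptyset$; and $d_\Gamma(X,f)=\sup\{\mu(A):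 A\in\mathcal{X}\text{ is }\Gamma\text{-admissible for } f\}$. A set $S\subseteq\mathbb{Z}^d$ is $\Gamma$-admissible if for every edge $uv$ of $\Gamma$ the translates $S-u$, $S-v$ are disjoint; and $M_\Gamma(N)=\max\{|S|/\pi(N): S\subseteq\mathbb{Z}^d\cap\prod_{i=1}^d[0,N(i))\text{ is }\Gamma\text{-admissible}\}$. *)

theory Defs
  imports "HOL-Probability.Probability"
begin

section \<open>Standard probability spaces\<close>

definition polish_topology :: "'a topology \<Rightarrow> bool" where
  "polish_topology T \<longleftrightarrow> completely_metrizable_space T \<and> separable_space T"

definition standard_borel :: "'a measure \<Rightarrow> bool" where
  "standard_borel M \<longleftrightarrow>
     (\<exists>T. polish_topology T \<and> space M = topspace T \<and>
          sets M = sigma_sets (topspace T) {U. openin T U})"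

text \<open>In the literature a standard probability space is either a standard Borel space with a
  probability measure, or the completion of such a space; in the latter case one often also
  allows a null set to be discarded (Lebesgue-Rokhlin spaces). The definition admits all of
  these; for \<open>Z = {}\<close> the restricted space is \<open>M\<close> itself.\<close>

definition standard_prob_space :: "'a measure \<Rightarrow> bool" where
  "standard_prob_space M \<longleftrightarrow> prob_space M \<and>
     (\<exists>Z\<in>null_sets M. \<exists>P. standard_borel P \<and>
        (restrict_space M (space M - Z) = P \<or>
         restrict_space M (space M - Z) = completion P))"

definition atomless :: "'a measure \<Rightarrow> bool" where
  "atomless M \<longleftrightarrow>
     (\<forall>A\<in>sets M. measure M A > 0 \<longrightarrow>
        (\<exists>B\<in>sets M. B \<subseteq> A \<and> 0 < measure M B \<and> measure M B < measure M A))"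

section \<open>Measure-preserving actions of \<open>\<nat>\<^sub>0\<^sup>d\<close>\<close>

definition measure_preserving_map :: "'a measure \<Rightarrow> ('a \<Rightarrow> 'a) \<Rightarrow> bool" where
  "measure_preserving_map M g \<longleftrightarrow>
     g \<in> measurable M M \<and>
     (\<forall>A\<in>sets M. emeasure M (g -` A \<inter> space M) = emeasure M A)"

definition mp_action :: "'a measure \<Rightarrow> (nat ^ 'd \<Rightarrow> 'a \<Rightarrow> 'a) \<Rightarrow> bool" where
  "mp_action M f \<longleftrightarrow>
     (\<forall>n. measure_preserving_map M (f n)) \<and>
     (\<forall>x\<in>space M. f 0 x = x) \<and>
     (\<forall>m n. \<forall>x\<in>space M. f (m + n) x = f m (f n x))"

text \<open>Stated with \<open>null_sets\<close> because \<open>measure M B = 0\<close> holds by convention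
  for every non-measurable \<open>B\<close>.\<close>

definition free_action :: "'a measure \<Rightarrow> (nat ^ 'd \<Rightarrow> 'a \<Rightarrow> 'a) \<Rightarrow> bool" where
  "free_action M f \<longleftrightarrow>
     (\<forall>k l. k \<noteq> l \<longrightarrow> {x \<in> space M. f k x = f l x} \<in> null_sets M)"

section \<open>Graphs and admissible sets\<close>

definition simple_graph :: "'v set \<Rightarrow> 'v set set \<Rightarrow> bool" where
  "simple_graph V E \<longleftrightarrow> (\<forall>e\<in>E. \<exists>u\<in>V. \<exists>v\<in>V. u \<noteq> v \<and> e = {u, v})"

definition admissible_for ::
  "(nat ^ 'd) set set \<Rightarrow> 'a measure \<Rightarrow> (nat ^ 'd \<Rightarrow> 'a \<Rightarrow> 'a) \<Rightarrow> 'a set \<Rightarrow> bool" where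
  "admissible_for E M f A \<longleftrightarrow>
     A \<in> sets M \<and> (\<forall>u v. {u, v} \<in> E \<longrightarrow> f u ` A \<inter> f v ` A = {})"

definition d_graph ::
  "(nat ^ 'd) set set \<Rightarrow> 'a measure \<Rightarrow> (nat ^ 'd \<Rightarrow> 'a \<Rightarrow> 'a) \<Rightarrow> real" where
  "d_graph E M f = (SUP A\<in>{A. admissible_for E M f A}. measure M A)"

definition int_vec :: "nat ^ 'd \<Rightarrow> int ^ 'd" where
  "int_vec u = (\<chi> i. int (u $ i))"

definition admissible_int :: "(nat ^ 'd) set set \<Rightarrow> (int ^ 'd) set \<Rightarrow> bool" where
  "admissible_int E S \<longleftrightarrow>
     (\<forall>u v. {u, v} \<in> E \<longrightarrow> (\<lambda>s. s - int_vec u) ` S \<inter> (\<lambda>s. s - int_vec v) ` S = {})"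

text \<open>Not the order \<open><\<close> on vectors from \<open>HOL-Analysis\<close>, which is
  componentwise \<open>\<le>\<close> with strictness in only one coordinate required.\<close>

definition all_less :: "nat ^ 'd \<Rightarrow> nat ^ 'd \<Rightarrow> bool" where
  "all_less k l \<longleftrightarrow> (\<forall>j. k $ j < l $ j)"

definition vec_prod :: "nat ^ 'd \<Rightarrow> nat" where
  "vec_prod N = (\<Prod>i\<in>UNIV. N $ i)"

definition int_box :: "nat ^ 'd \<Rightarrow> (int ^ 'd) set" where
  "int_box N = {k. \<forall>i. 0 \<le> k $ i \<and> k $ i < int (N $ i)}"

definition M_graph :: "(nat ^ 'd) set set \<Rightarrow> nat ^ 'd \<Rightarrow> real" where
  "M_graph E N =
     Max {real (card S) / real (vec_prod N) | S. S \<subseteq> int_box N \<and> admissible_int E S}"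

end

theory Submission
  imports Defs "HOL-Real_Asymp.Real_Asymp"
begin

text \<open>Upper bound: if \<open>A\<close> is admissible, then for every \<open>x\<close> the visit set \<open>{k. f k x \<in> A}\<close> inside the
  box of shape \<open>N\<close> is admissible; integrating its cardinality gives \<open>\<mu>(A) \<le> M_graph E N\<close>.

  Lower bound: let \<open>S\<close> be an admissible pattern of shape \<open>N\<close> and suppose that
  \<open>C\<close> is a set whose preimages \<open>f k -` C\<close>, with \<open>k\<close> in the box of shape \<open>N + 2m\<close>, are disjoint.
  Overwriting an admissible set \<open>A\<close> on this tower by the pattern, with margins of width \<open>m\<close>, yields
  an admissible set again. Up to a null set, \<open>X\<close> is a countable disjoint union of such sets \<open>C\<close>, and
  by averaging, for one of them the part of \<open>A\<close> in the tower has relative measure at most \<open>\<mu>(A)\<close>; hence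
  \<open>A\<close> can be improved, by an amount proportional to the measure of the change, as long as
  \<open>\<mu>(A) < |S| / \<pi>(N + 2m)\<close>. By Ekeland's principle, \<open>d_graph E M f \<ge> |S| / \<pi>(N + 2m)\<close>. Applying
  this to \<open>K\<^sup>d\<close> translates of \<open>S\<close> arranged with period \<open>N + m\<close> and letting \<open>K \<rightarrow> \<infinity>\<close> replaces
  the denominator by \<open>\<pi>(N + m)\<close>.\<close>

section \<open>Separated patterns in boxes\<close>

definition nat_box :: "nat ^ 'd \<Rightarrow> (nat ^ 'd) set" where
  "nat_box N = {k. all_less k N}"

lemma mem_nat_box: "k \<in> nat_box N \<longleftrightarrow> (\<forall>i. k $ i < N $ i)"
  by (simp add: nat_box_def all_less_def)

lemma finite_nat_box: "finite (nat_box N)" (is ?fin)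
  and card_nat_box: "card (nat_box N) = vec_prod N" (is ?card)
proof -
  have "bij_betw vec_lambda (\<Pi>\<^sub>E i\<in>UNIV. {..<N $ i}) (nat_box N)"
    by (rule bij_betwI[where g = vec_nth]) (auto simp: mem_nat_box PiE_iff)
  then show ?fin ?card
    by (simp_all add: bij_betw_finite[symmetric] bij_betw_same_card[symmetric] finite_PiE card_PiE
        vec_prod_def)
qed

lemma vec_prod_pos: "(\<forall>i. 0 < N $ i) \<Longrightarrow> 0 < vec_prod N"
  by (simp add: vec_prod_def prod_pos)

section \<open>Admissible patterns with natural coordinates\<close>

text \<open>Disjointness of \<open>S - u\<close> and \<open>S - v\<close>, written with sums because
  subtraction of natural vectors truncates. Edges are unordered, so it does not matter which shift
  goes with which point.\<close>

definition sum_separated :: "(nat ^ 'd) set set \<Rightarrow> (nat ^ 'd) set \<Rightarrow> bool" where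
  "sum_separated E S \<longleftrightarrow> (\<forall>u v. {u, v} \<in> E \<longrightarrow> (\<forall>s\<in>S. \<forall>t\<in>S. s + u \<noteq> t + v))"

lemma inj_int_vec: "inj int_vec"
  by (auto simp: inj_def int_vec_def vec_eq_iff)

lemma int_vec_diff_eq_iff: "int_vec s - int_vec u = int_vec t - int_vec v \<longleftrightarrow> s + v = t + u"
proof -
  have "int a - int b = int c - int d \<longleftrightarrow> a + d = c + b" for a b c d
    by linarith
  then show ?thesis
    by (simp add: int_vec_def vec_eq_iff)
qed

lemma admissible_int_int_vec: "admissible_int E (int_vec ` S) \<longleftrightarrow> sum_separated E S"
proof -
  have "((\<lambda>s. s - int_vec u) ` int_vec ` S \<inter> (\<lambda>s. s - int_vec v) ` int_vec ` S = {}) \<longleftrightarrow>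
        (\<forall>s\<in>S. \<forall>t\<in>S. s + v \<noteq> t + u)" for u v
    unfolding int_vec_diff_eq_iff[symmetric] by blast
  then have "admissible_int E (int_vec ` S) \<longleftrightarrow>
      (\<forall>u v. {u, v} \<in> E \<longrightarrow> (\<forall>s\<in>S. \<forall>t\<in>S. s + v \<noteq> t + u))"
    unfolding admissible_int_def by blast
  also have "\<dots> \<longleftrightarrow> sum_separated E S"
  proof -
    have "{u, v} = {v, u}" for u v :: "nat ^ 'a" by blast
    then show ?thesis unfolding sum_separated_def by metis
  qed
  finally show ?thesis .
qed

lemma int_box_eq: "int_box N = int_vec ` nat_box N"
proof (rule set_eqI, rule iffI)
  fix k assume k: "k \<in> int_box N"
  then have "k = int_vec (\<chi> i. nat (k $ i))" "(\<chi> i. nat (k $ i)) \<in> nat_box N"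
    by (auto simp: int_box_def int_vec_def vec_eq_iff mem_nat_box nat_less_iff)
  then show "k \<in> int_vec ` nat_box N" by blast
qed (auto simp: int_box_def int_vec_def mem_nat_box)

lemma M_graph_eq:
  "M_graph E N = Max ((\<lambda>S. real (card S) / real (vec_prod N)) ` {S. S \<subseteq> nat_box N \<and> sum_separated E S})"
proof -
  have "{S. S \<subseteq> int_box N \<and> admissible_int E S} =
      (`) int_vec ` {S. S \<subseteq> nat_box N \<and> sum_separated E S}"
    unfolding int_box_eq by (auto simp: subset_image_iff admissible_int_int_vec)
  moreover have "card (int_vec ` S) = card S" for S :: "(nat ^ 'a) set"
    by (rule card_image) (rule inj_on_subset[OF inj_int_vec subset_UNIV])
  moreover have "{real (card S) / real (vec_prod N) | S. S \<subseteq> int_box N \<and> admissible_int E S} =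
      (\<lambda>S. real (card S) / real (vec_prod N)) ` {S. S \<subseteq> int_box N \<and> admissible_int E S}"
    by blast
  ultimately show ?thesis by (simp add: M_graph_def image_image)
qed

lemma finite_sum_separated: "finite {S. S \<subseteq> nat_box N \<and> sum_separated E S}"
  by (rule finite_subset[of _ "Pow (nat_box N)"]) (auto simp: finite_nat_box)

lemma card_le_M_graph:
  assumes "\<forall>i. 0 < N $ i" "S \<subseteq> nat_box N" "sum_separated E S"
  shows "real (card S) \<le> M_graph E N * real (vec_prod N)"
proof -
  have "real (card S) / real (vec_prod N) \<le> M_graph E N"
    unfolding M_graph_eq using assms finite_sum_separated by (intro Max_ge finite_imageI) auto
  with vec_prod_pos[OF assms(1)] show ?thesis by (simp add: field_simps)
qed

lemma M_graph_attained:
  obtains S where "S \<subseteq> nat_box N" "sum_separated E S"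
    "M_graph E N = real (card S) / real (vec_prod N)"
proof -
  have "{} \<in> {S. S \<subseteq> nat_box N \<and> sum_separated E S}"
    by (simp add: sum_separated_def)
  then have "M_graph E N \<in> (\<lambda>S. real (card S) / real (vec_prod N)) ` {S. S \<subseteq> nat_box N \<and> sum_separated E S}"
    unfolding M_graph_eq using finite_sum_separated by (intro Max_in finite_imageI) auto
  then show ?thesis using that by auto
qed

section \<open>Periodic arrangements of a pattern\<close>

definition tile :: "nat ^ 'd \<Rightarrow> (nat ^ 'd) set \<Rightarrow> nat \<Rightarrow> (nat ^ 'd) set" where
  "tile L S K = (\<lambda>(j, s). L * j + s) ` (nat_box (\<chi> i. K) \<times> S)"

text \<open>Division with remainder by \<open>L $ i\<close> in every coordinate.\<close>

lemma mixed_radix_unique: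
  fixes a b c d L :: "nat ^ 'd"
  assumes "L * a + b = L * c + d" "all_less b L" "all_less d L"
  shows "a = c \<and> b = d"
proof -
  have "a $ i = c $ i \<and> b $ i = d $ i" for i
  proof -
    have eq: "L $ i * a $ i + b $ i = L $ i * c $ i + d $ i" "b $ i < L $ i" "d $ i < L $ i"
      using assms by (simp_all add: vec_eq_iff all_less_def)
    have "a $ i = (L $ i * a $ i + b $ i) div L $ i" using eq(2) by simp
    also have "\<dots> = c $ i" unfolding eq(1) using eq(3) by simp
    finally show ?thesis using eq(1) by simp
  qed
  then show ?thesis by (simp add: vec_eq_iff)
qed

lemma tile_subset:
  assumes "S \<subseteq> nat_box L"
  shows "tile L S K \<subseteq> nat_box ((\<chi> i. K) * L)"
proof -
  have "L $ i * j + s < K * L $ i" if "j < K" "s < L $ i" for i j s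
  proof -
    have "L $ i * j + s < L $ i * Suc j" using that by simp
    also have "\<dots> \<le> L $ i * K" using that by (intro mult_le_mono) auto
    finally show ?thesis by (simp add: mult.commute)
  qed
  then show ?thesis
    using assms by (auto simp: tile_def mem_nat_box subset_iff)
qed

lemma card_tile:
  fixes L :: "nat ^ 'd"
  assumes "S \<subseteq> nat_box L"
  shows "card (tile L S K) = K ^ CARD('d) * card S"
proof -
  have "inj_on (\<lambda>(j, s). L * j + s) (nat_box (\<chi> i. K) \<times> S)"
    using assms by (auto simp: inj_on_def nat_box_def subset_iff dest: mixed_radix_unique[of L])
  then show ?thesis
    by (simp add: tile_def card_image card_cartesian_product card_nat_box vec_prod_def)
qed

text \<open>The period \<open>N + m\<close> leaves a gap of width \<open>m\<close> between copies,
  so \<open>s + u\<close> and \<open>t + v\<close> are still remainders modulo the period; a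
  coincidence between shifted copies is therefore one between shifted points of \<open>S\<close>
  itself.\<close>

lemma sum_separated_tile:
  assumes "S \<subseteq> nat_box N" "sum_separated E S"
    and E: "\<forall>e\<in>E. \<forall>u\<in>e. all_less u m"
  shows "sum_separated E (tile (N + m) S K)"
proof -
  have False
    if "{u, v} \<in> E" "s \<in> S" "t \<in> S" "(N + m) * j + s + u = (N + m) * j' + t + v" for u v s t j j'
  proof -
    have "all_less u m" "all_less v m" using that(1) E by auto
    then have "all_less (s + u) (N + m)" "all_less (t + v) (N + m)"
      using that assms(1)
      by (auto simp: all_less_def mem_nat_box add_strict_mono subset_iff)
    with mixed_radix_unique[of "N + m" j "s + u" j' "t + v"] that have "s + u = t + v"
      by (simp add: add.assoc)
    with that assms(2) show False by (auto simp: sum_separated_def)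
  qed
  then show ?thesis by (auto simp: sum_separated_def tile_def)
qed

text \<open>The density factors over the coordinates, and a margin \<open>c\<close> that stays fixed
  is negligible as \<open>K\<close> grows. With \<open>c = m + m\<close> this removes the margins of
  the tower from the final bound.\<close>

lemma tile_density_tendsto:
  fixes L c :: "nat ^ 'd"
  assumes "\<forall>i. 0 < L $ i"
  shows "(\<lambda>K. real (K ^ CARD('d)) / real (vec_prod ((\<chi> i. K) * L + c)))
    \<longlonglongrightarrow> 1 / real (vec_prod L)"
proof -
  have lim: "(\<lambda>K. real K / (real K * real (L $ i) + real (c $ i))) \<longlonglongrightarrow> 1 / real (L $ i)" for i
  proof -
    have "0 < real (L $ i)" using assms by simp
    then show ?thesis unfolding inverse_eq_divide[symmetric] by real_asymp
  qed
  have "(\<lambda>K. \<Prod>i\<in>UNIV. real K / (real K * real (L $ i) + real (c $ i))) \<longlonglongrightarrow>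
    (\<Prod>i\<in>UNIV. 1 / real (L $ i))"
    by (intro tendsto_prod lim)
  then show ?thesis
    by (simp add: vec_prod_def prod_dividef)
qed

section \<open>Towers of a free action\<close>

text \<open>Take balls of radius \<open>1 / (n + 1)\<close> around a countable dense set: if the
  radius is below half the distance of \<open>a\<close> and \<open>b\<close>, a ball containing
  \<open>a\<close> misses \<open>b\<close>.\<close>

lemma polish_topology_separating:
  assumes "polish_topology T"
  obtains U :: "nat \<Rightarrow> 'a set" where "\<And>n. openin T (U n)"
    "\<And>a b. a \<in> topspace T \<Longrightarrow> b \<in> topspace T \<Longrightarrow> a \<noteq> b \<Longrightarrow> \<exists>n. a \<in> U n \<and> b \<notin> U n"
proof -
  obtain X d where "Metric_space X d" and T: "T = Metric_space.mtopology X d"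
    using assms unfolding polish_topology_def completely_metrizable_space_def by blast
  then interpret Metric_space X d by simp
  obtain D where D: "countable D" "D \<subseteq> X" "mtopology closure_of D = X"
    using assms by (auto simp: polish_topology_def separable_space_def T)
  \<comment> \<open>The empty set keeps the family nonempty even when \<open>D\<close> is empty, so
    that \<open>from_nat_into\<close> enumerates it.\<close>
  define B where "B = insert {} ((\<lambda>(c, n). mball c (1 / real (Suc n))) ` (D \<times> UNIV))"
  have "countable B" "B \<noteq> {}" using D by (auto simp: B_def)
  then have rng: "range (from_nat_into B) = B" by (intro range_from_nat_into)
  show ?thesis
  proof (rule that)
    show "openin T (from_nat_into B n)" for n
    proof -
      have "from_nat_into B n \<in> B" using \<open>B \<noteq> {}\<close> by (rule from_nat_into)
      moreover have "openin T W" if "W \<in> B" for W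
        using that unfolding B_def T by auto
      ultimately show ?thesis by blast
    qed
    fix a b assume ab: "a \<in> topspace T" "b \<in> topspace T" "a \<noteq> b"
    then have X: "a \<in> X" "b \<in> X" by (simp_all add: T)
    with ab have "0 < d a b / 2" by simp
    then obtain n where n: "1 / real (Suc n) < d a b / 2"
      by (rule nat_approx_posE)
    have "\<forall>r>0. \<exists>c\<in>D. c \<in> mball a r"
      using D(3) X(1) unfolding metric_closure_of by blast
    then obtain c where c: "c \<in> D" "c \<in> mball a (1 / real (Suc n))"
      by (meson of_nat_0_less_iff zero_less_Suc zero_less_divide_1_iff)
    have "d a b \<le> d c a + d c b" using c X D by (metis commute triangle subset_eq)
    with c n have "a \<in> mball c (1 / real (Suc n))" "b \<notin> mball c (1 / real (Suc n))"
      using X by (auto simp: commute)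
    moreover have "mball c (1 / real (Suc n)) \<in> B"
      using c by (auto simp: B_def)
    ultimately show "\<exists>n. a \<in> from_nat_into B n \<and> b \<notin> from_nat_into B n"
      using rng by (metis imageE)
  qed
qed

text \<open>The separating sets are open, hence measurable in \<open>P\<close> and in its completion
  alike; as \<open>Z\<close> is measurable in \<open>M\<close>, so are they.\<close>

lemma standard_prob_space_separating:
  assumes "standard_prob_space M"
  obtains Z and U :: "nat \<Rightarrow> 'a set" where "Z \<in> null_sets M" "\<And>n. U n \<in> sets M"
    "\<And>a b. a \<in> space M - Z \<Longrightarrow> b \<in> space M - Z \<Longrightarrow> a \<noteq> b \<Longrightarrow> \<exists>n. a \<in> U n \<and> b \<notin> U n"
proof -
  obtain Z P where Z: "Z \<in> null_sets M" and P: "standard_borel P"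
    and M: "restrict_space M (space M - Z) = P \<or> restrict_space M (space M - Z) = completion P"
    using assms unfolding standard_prob_space_def by blast
  have space: "space P = space M - Z"
    using M by (metis Diff_subset space_completion space_restrict_space2 sets.compl_sets null_setsD2[OF Z])
  have "sets P \<subseteq> sets (restrict_space M (space M - Z))"
    using M by auto
  moreover have "sets (restrict_space M (space M - Z)) \<subseteq> sets M"
    using Z by (auto simp: sets_restrict_space)
  ultimately have sets: "sets P \<subseteq> sets M" by blast
  obtain T where T: "polish_topology T" "space P = topspace T"
    "sets P = sigma_sets (topspace T) {U. openin T U}"
    using P unfolding standard_borel_def by blast
  obtain U :: "nat \<Rightarrow> 'a set" where "\<And>n. openin T (U n)"
    "\<And>a b. a \<in> topspace T \<Longrightarrow> b \<in> topspace T \<Longrightarrow> a \<noteq> b \<Longrightarrow> \<exists>n. a \<in> U n \<and> b \<notin> U n"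
    using polish_topology_separating[OF T(1)] by blast
  moreover from this have "U n \<in> sets M" for n
    using sets T(3) by auto
  ultimately show ?thesis
    using that[OF Z, of U] space T(2) by simp
qed

section \<open>Preimages under an action\<close>

lemma mp_action_measurable: "mp_action M f \<Longrightarrow> f k \<in> measurable M M"
  by (simp add: mp_action_def measure_preserving_map_def)

lemma mp_action_vimage_sets: "mp_action M f \<Longrightarrow> A \<in> sets M \<Longrightarrow> f k -` A \<inter> space M \<in> sets M"
  by (metis mp_action_measurable measurable_sets)

lemma mp_action_emeasure_vimage:
  "mp_action M f \<Longrightarrow> A \<in> sets M \<Longrightarrow> emeasure M (f k -` A \<inter> space M) = emeasure M A"
  by (simp add: mp_action_def measure_preserving_map_def)

lemma mp_action_measure_vimage:
  "mp_action M f \<Longrightarrow> A \<in> sets M \<Longrightarrow> measure M (f k -` A \<inter> space M) = measure M A"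
  by (simp add: measure_def mp_action_emeasure_vimage)

lemma mp_action_vimage_null_sets:
  "mp_action M f \<Longrightarrow> A \<in> null_sets M \<Longrightarrow> f k -` A \<inter> space M \<in> null_sets M"
  by (simp add: null_sets_def mp_action_emeasure_vimage mp_action_vimage_sets)

lemma mp_action_space: "mp_action M f \<Longrightarrow> x \<in> space M \<Longrightarrow> f k x \<in> space M"
  by (metis mp_action_measurable measurable_space)

lemma mp_action_add: "mp_action M f \<Longrightarrow> x \<in> space M \<Longrightarrow> f k (f l x) = f (k + l) x"
  by (simp add: mp_action_def)

section \<open>Tower bases and averaging\<close>

text \<open>A Rokhlin tower for maps that need not be invertible: the levels are preimages of
  \<open>C\<close>, which are measurable and have the measure of \<open>C\<close>, whereas images
  need have neither property.\<close>

definition tower_base :: "(nat ^ 'd) set \<Rightarrow> 'a measure \<Rightarrow> (nat ^ 'd \<Rightarrow> 'a \<Rightarrow> 'a) \<Rightarrow> 'a set \<Rightarrow> bool" where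
  "tower_base R M f C \<longleftrightarrow>
     C \<in> sets M \<and> disjoint_family_on (\<lambda>k. f k -` C \<inter> space M) R"

text \<open>Color a point \<open>c\<close> by the sets \<open>U n\<close> that tell the points \<open>f (P - k) c\<close>, \<open>k \<in> R\<close>, apart.
  Since \<open>f (P - k) (f k x) = f P x\<close> does not depend on \<open>k\<close>, two points \<open>f k x\<close> and \<open>f l x\<close> with
  \<open>k \<noteq> l\<close> never have the same color. Looking at the future orbit of \<open>c\<close> is essential, because
  the maps \<open>f k\<close> need not be injective and \<open>c\<close> may have uncountably many preimages.\<close>

lemma mp_action_tower_base_cover:
  fixes f :: "nat ^ 'd \<Rightarrow> 'a \<Rightarrow> 'a"
  assumes M: "standard_prob_space M" and f: "mp_action M f" "free_action M f"
    and R: "finite R" "\<And>k. k \<in> R \<Longrightarrow> \<forall>i. k $ i \<le> P $ i"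
  obtains C :: "nat \<Rightarrow> 'a set" where "\<And>n. tower_base R M f (C n)"
    "disjoint_family C" "space M - (\<Union>n. C n) \<in> null_sets M"
proof -
  obtain Z and U :: "nat \<Rightarrow> 'a set" where Z: "Z \<in> null_sets M" and U: "\<And>n. U n \<in> sets M"
    and sep: "\<And>a b. a \<in> space M - Z \<Longrightarrow> b \<in> space M - Z \<Longrightarrow> a \<noteq> b \<Longrightarrow> \<exists>n. a \<in> U n \<and> b \<notin> U n"
    using standard_prob_space_separating[OF M] by blast
  \<comment> \<open>As \<open>P\<close> dominates \<open>R\<close>, the subtraction does not
    truncate and \<open>k\<close> can be recovered from \<open>P - k\<close>.\<close>
  define g where "g k = f (P - k)" for k
  define pairs where "pairs = {(k, l). k \<in> R \<and> l \<in> R \<and> k \<noteq> l}"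
  have "pairs \<subseteq> R \<times> R" by (auto simp: pairs_def)
  then have fin: "finite pairs" using R(1) by (blast intro: finite_subset)
  have inj: "P - k \<noteq> P - l" if "(k, l) \<in> pairs" for k l
  proof
    assume "P - k = P - l"
    then have "P $ i - k $ i = P $ i - l $ i" for i by (simp add: vec_eq_iff)
    moreover have "k $ i \<le> P $ i" "l $ i \<le> P $ i" for i
      using that R(2) by (auto simp: pairs_def)
    ultimately have "k $ i = l $ i" for i by (metis diff_diff_cancel)
    with that show False by (simp add: pairs_def vec_eq_iff)
  qed
  \<comment> \<open>The points that may fail to have a color: some \<open>g k c\<close> lies in the
    exceptional set, or two of these points coincide. Freeness makes the second part null.\<close>
  define bad where "bad = (\<Union>k\<in>R. g k -` Z \<inter> space M) \<union>
    (\<Union>(k, l)\<in>pairs. {x \<in> space M. g k x = g l x})"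
  have bad: "bad \<in> null_sets M"
    unfolding bad_def g_def using f inj Z R(1) fin
    by (intro null_sets.Un null_sets_UN' countable_finite mp_action_vimage_null_sets)
       (auto simp: free_action_def)
  \<comment> \<open>A color picks for each pair the index of a set that tells its two points apart.
    Extensional functions on the finite set \<open>pairs\<close> form a countable set.\<close>
  define I where "I = (\<Pi>\<^sub>E p\<in>pairs. (UNIV :: nat set))"
  have "countable I" unfolding I_def using fin by (intro countable_PiE) auto
  define C0 where "C0 n = {c \<in> space M. \<forall>(k, l)\<in>pairs. g k c \<in> U (n (k, l)) \<and> g l c \<notin> U (n (k, l))}"
    for n
  \<comment> \<open>A point may have several colors; \<open>disjointed\<close> keeps the
    first.\<close>
  define C where "C = disjointed (\<lambda>i. C0 (from_nat_into I i))"
  have C0_sets: "C0 n \<in> sets M" for n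
  proof -
    have *: "{c \<in> space M. g k c \<in> U j} \<in> sets M" for k j
      using mp_action_vimage_sets[OF f(1) U[of j], of "P - k"]
      by (simp add: vimage_def Int_def conj_commute g_def)
    have "C0 n = {c \<in> space M. \<forall>p\<in>pairs. g (fst p) c \<in> U (n p) \<and> g (snd p) c \<notin> U (n p)}"
      by (auto simp: C0_def)
    also have "\<dots> \<in> sets M"
      using fin * by (intro sets.sets_Collect_finite_All sets.sets_Collect_conj
          sets.sets_Collect_neg) auto
    finally show ?thesis .
  qed
  have C_sets: "C n \<in> sets M" for n
    using sets.range_disjointed_sets[of "\<lambda>i. C0 (from_nat_into I i)" M] C0_sets
    by (auto simp: C_def)
  have "tower_base R M f (C n)" for n
    unfolding tower_base_def
    disjoint_family_on_def
  proof (intro conjI C_sets ballI impI)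
    fix k l assume kl: "k \<in> R" "l \<in> R" "k \<noteq> l"
    show "(f k -` C n \<inter> space M) \<inter> (f l -` C n \<inter> space M) = {}"
    proof (rule ccontr)
      assume "(f k -` C n \<inter> space M) \<inter> (f l -` C n \<inter> space M) \<noteq> {}"
      then obtain x where x: "x \<in> space M" "f k x \<in> C n" "f l x \<in> C n" by auto
      obtain j where j: "C n \<subseteq> C0 j"
        using disjointed_subset[of "\<lambda>i. C0 (from_nat_into I i)" n] by (auto simp: C_def)
      have add: "P - k + k = P" "P - l + l = P"
        using kl R(2) by (auto simp: vec_eq_iff)
      have "g k (f k x) = g l (f l x)"
        using add by (simp add: g_def mp_action_add[OF f(1) x(1)])
      moreover have "g k (f k x) \<in> U (j (k, l))" "g l (f l x) \<notin> U (j (k, l))"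
        using x j kl by (auto simp: C0_def pairs_def)
      ultimately show False by simp
    qed
  qed
  moreover have "disjoint_family C"
    unfolding C_def by (rule disjoint_family_disjointed)
  moreover have "space M - (\<Union>n. C n) \<in> null_sets M"
  proof (rule null_sets_subset[OF bad])
    show "space M - (\<Union>n. C n) \<in> sets M" using C_sets by auto
    show "space M - (\<Union>n. C n) \<subseteq> bad"
    proof
      fix c assume c: "c \<in> space M - (\<Union>n. C n)"
      show "c \<in> bad"
      proof (rule ccontr)
        assume "c \<notin> bad"
        then have good: "\<And>k. k \<in> R \<Longrightarrow> g k c \<in> space M - Z"
          "\<And>k l. (k, l) \<in> pairs \<Longrightarrow> g k c \<noteq> g l c"
          using c by (auto simp: bad_def g_def mp_action_space[OF f(1)])
        have "\<exists>n. g k c \<in> U n \<and> g l c \<notin> U n" if "(k, l) \<in> pairs" for k l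
          using that good by (intro sep) (auto simp: pairs_def)
        then have "\<forall>p\<in>pairs. \<exists>n. g (fst p) c \<in> U n \<and> g (snd p) c \<notin> U n" by auto
        then obtain n where n: "\<forall>p\<in>pairs. g (fst p) c \<in> U (n p) \<and> g (snd p) c \<notin> U (n p)"
          by (metis (no_types))
        then have "c \<in> C0 (restrict n pairs)"
          using c by (auto simp: C0_def)
        moreover have "restrict n pairs \<in> I" by (auto simp: I_def)
        ultimately have "c \<in> (\<Union>i. C0 (from_nat_into I i))"
          using \<open>countable I\<close> by (metis UN_iff UNIV_I from_nat_into_surj)
        then show False using c by (simp add: C_def UN_disjointed_eq)
      qed
    qed
  qed
  ultimately show ?thesis using that by blast
qed

text \<open>For fixed \<open>k\<close> the preimages of the sets \<open>C n\<close> partition the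
  space up to a null set, so both sides, summed over the cover, equal
  \<open>card R * measure M A\<close>. Hence the inequality cannot fail for every \<open>C n\<close>
  of positive measure.\<close>

lemma exists_tower_base_le_average:
  fixes f :: "nat ^ 'd \<Rightarrow> 'a \<Rightarrow> 'a"
  assumes M: "standard_prob_space M" and f: "mp_action M f" "free_action M f"
    and R: "finite R" "\<And>k. k \<in> R \<Longrightarrow> \<forall>i. k $ i \<le> P $ i" and A: "A \<in> sets M"
  obtains C where "tower_base R M f C" "0 < measure M C"
    "(\<Sum>k\<in>R. measure M (A \<inter> (f k -` C \<inter> space M))) \<le> real (card R) * measure M A * measure M C"
proof -
  interpret prob_space M using M by (simp add: standard_prob_space_def)
  obtain C :: "nat \<Rightarrow> 'a set" where C: "\<And>n. tower_base R M f (C n)" "disjoint_family C"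
    and null: "space M - (\<Union>n. C n) \<in> null_sets M"
    using mp_action_tower_base_cover[OF M f R] by blast
  have C_sets: "C n \<in> sets M" for n using C(1) by (simp add: tower_base_def)
  define h where "h n = (\<Sum>k\<in>R. measure M (A \<inter> (f k -` C n \<inter> space M)))" for n
  define c where "c = real (card R) * measure M A"
  have "(\<lambda>n. measure M (C n)) sums measure M (\<Union>n. C n)"
    using C_sets C(2) by (intro finite_measure_UNION) auto
  moreover have "measure M (\<Union>n. C n) = 1"
  proof -
    have "(\<Union>n. C n) \<in> sets M" using C_sets by auto
    then show ?thesis
      using null prob_compl[of "\<Union>n. C n"] by (simp add: measure_eq_0_null_sets)
  qed
  ultimately have sum1: "(\<lambda>n. measure M (C n)) sums 1" by simp
  have "(\<lambda>n. measure M (A \<inter> (f k -` C n \<inter> space M))) sums measure M A" for k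
  proof -
    have "(\<lambda>n. measure M (A \<inter> (f k -` C n \<inter> space M))) sums
      measure M (\<Union>n. A \<inter> (f k -` C n \<inter> space M))"
    proof (rule finite_measure_UNION)
      show "range (\<lambda>n. A \<inter> (f k -` C n \<inter> space M)) \<subseteq> sets M"
        using A C_sets f by (auto intro!: sets.Int mp_action_vimage_sets)
      show "disjoint_family (\<lambda>n. A \<inter> (f k -` C n \<inter> space M))"
        using C(2) by (fastforce simp: disjoint_family_on_def)
    qed
    moreover have "measure M (\<Union>n. A \<inter> (f k -` C n \<inter> space M)) = measure M A"
    proof -
      have "(\<Union>n. A \<inter> (f k -` C n \<inter> space M)) = A - (f k -` (space M - (\<Union>n. C n)) \<inter> space M)"
        using sets.sets_into_space[OF A] mp_action_space[OF f(1)] by auto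
      then show ?thesis
        using measure_Diff_null_set[OF A mp_action_vimage_null_sets[OF f(1) null]] by simp
    qed
    ultimately show ?thesis by simp
  qed
  then have "h sums (\<Sum>k\<in>R. measure M A)"
    unfolding h_def by (intro sums_sum) auto
  then have sumh: "h sums c" by (simp add: c_def)
  have "(\<lambda>n. h n - c * measure M (C n)) sums 0"
    using sums_diff[OF sumh sums_mult[OF sum1, of c]] by simp
  then have diff: "summable (\<lambda>n. h n - c * measure M (C n))" "(\<Sum>n. h n - c * measure M (C n)) = 0"
    by (auto simp: sums_iff)
  \<comment> \<open>Otherwise the series with sum 0 has nonnegative terms, also where
    \<open>C n\<close> is null; so all terms vanish and every \<open>C n\<close> is null, against
    total measure 1.\<close>
  have "\<exists>n. 0 < measure M (C n) \<and> h n \<le> c * measure M (C n)"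
  proof (rule ccontr)
    assume neg: "\<nexists>n. 0 < measure M (C n) \<and> h n \<le> c * measure M (C n)"
    have "0 \<le> h n" for n by (simp add: h_def sum_nonneg)
    then have ge: "0 \<le> h n - c * measure M (C n)" for n
      using neg measure_nonneg[of M "C n"] by (cases "measure M (C n) = 0") (auto simp: less_le not_le)
    then have "h n - c * measure M (C n) = 0" for n
      using diff suminf_eq_zero_iff[OF diff(1) ge] by simp
    then have "measure M (C n) = 0" for n
      using neg measure_nonneg[of M "C n"] by (metis eq_iff_diff_eq_0 order_refl less_le)
    then show False using sum1 by (simp add: sums_iff)
  qed
  then show ?thesis using that[of "C n" for n] C(1) by (auto simp: h_def c_def)
qed

section \<open>Admissible sets of large measure\<close>

text \<open>If \<open>s + u = t + v\<close> for visit times \<open>s\<close>, \<open>t\<close> of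
  \<open>x\<close> and an edge \<open>{u, v}\<close>, then \<open>f (s + u) x\<close> lies in the
  images of \<open>A\<close> under both \<open>f u\<close> and \<open>f v\<close>. So visit sets are
  separated, while the mean number of visits is \<open>vec_prod N * measure M A\<close>.\<close>

lemma measure_admissible_le_M_graph:
  fixes f :: "nat ^ 'd \<Rightarrow> 'a \<Rightarrow> 'a"
  assumes "prob_space M" and f: "mp_action M f" and A: "admissible_for E M f A"
    and N: "\<forall>i. 0 < N $ i"
  shows "measure M A \<le> M_graph E N"
proof -
  interpret prob_space M by fact
  define T where "T k = f k -` A \<inter> space M" for k
  have A_sets: "A \<in> sets M" using A by (simp add: admissible_for_def)
  have T: "T k \<in> sets M" "measure M (T k) = measure M A" for k
    using f A_sets by (simp_all add: T_def mp_action_vimage_sets mp_action_measure_vimage)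
  have "(\<Sum>k\<in>nat_box N. indicator (T k) x) \<le> M_graph E N * real (vec_prod N)"
    if x: "x \<in> space M" for x
  proof -
    define S where "S = {k \<in> nat_box N. f k x \<in> A}"
    have "sum_separated E S"
      unfolding sum_separated_def
    proof (intro allI impI ballI notI)
      fix u v s t assume uv: "{u, v} \<in> E" and st: "s \<in> S" "t \<in> S" "s + u = t + v"
      have "f u (f s x) = f v (f t x)"
        using st(3) by (simp add: mp_action_add[OF f x] add.commute)
      moreover have "f u (f s x) \<in> f u ` A" "f v (f t x) \<in> f v ` A"
        using st by (auto simp: S_def)
      moreover have "f u ` A \<inter> f v ` A = {}"
        using A uv by (simp add: admissible_for_def)
      ultimately show False by auto
    qed
    then have "real (card S) \<le> M_graph E N * real (vec_prod N)"
      using N by (intro card_le_M_graph) (auto simp: S_def)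
    moreover have "(\<Sum>k\<in>nat_box N. indicator (T k) x) = real (card S)"
    proof -
      have "(\<Sum>k\<in>nat_box N. indicator (T k) x) = (\<Sum>k\<in>nat_box N. if f k x \<in> A then 1 else (0::real))"
        using x by (intro sum.cong) (auto simp: T_def indicator_def)
      then show ?thesis
        by (simp add: S_def sum.If_cases finite_nat_box Int_def)
    qed
    ultimately show ?thesis by simp
  qed
  then have "(\<integral>x. (\<Sum>k\<in>nat_box N. indicator (T k) x) \<partial>M) \<le> (\<integral>x. M_graph E N * real (vec_prod N) \<partial>M)"
    using T by (intro integral_mono) (auto simp: emeasure_eq_measure)
  also have "(\<integral>x. (\<Sum>k\<in>nat_box N. indicator (T k) x) \<partial>M) = (\<Sum>k\<in>nat_box N. measure M (T k))"
    using T by (subst Bochner_Integration.integral_sum) (auto simp: emeasure_eq_measure)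
  also have "\<dots> = real (vec_prod N) * measure M A"
    by (simp add: T card_nat_box)
  finally show ?thesis
    using vec_prod_pos[OF N] by (simp add: prob_space mult.commute[of _ "real _"])
qed

text \<open>Ekeland's variational principle in the measure algebra. The limit is taken as a set-theoretic
  liminf, so that closedness of \<open>\<A>\<close> is a pointwise condition without exceptional null sets.\<close>

lemma (in finite_measure) ekeland_sets:
  assumes sets: "\<A> \<subseteq> sets M" and ne: "\<A> \<noteq> {}"
    and lim: "\<And>A :: nat \<Rightarrow> 'a set. (\<And>n. A n \<in> \<A>) \<Longrightarrow> (\<Union>n. \<Inter>k\<in>{n..}. A k) \<in> \<A>"
    and pos: "0 < \<kappa>"
  obtains A where "A \<in> \<A>"
    "\<And>B. B \<in> \<A> \<Longrightarrow> \<kappa> * measure M (sym_diff A B) \<le> measure M B - measure M A \<Longrightarrow>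
      measure M B \<le> measure M A"
proof -
  \<comment> \<open>Ekeland's order: the measure must grow by at least \<open>\<kappa>\<close> times
    the measure of the change.\<close>
  define le where "le A B \<longleftrightarrow> \<kappa> * measure M (sym_diff A B) \<le> measure M B - measure M A" for A B
  have le_refl: "le A A" for A by (simp add: le_def)
  have le_measure: "measure M A \<le> measure M B" if "le A B" for A B
  proof -
    have "0 \<le> \<kappa> * measure M (sym_diff A B)" using pos by simp
    with that show ?thesis by (simp add: le_def)
  qed
  have le_trans: "le A C" if "le A B" "le B C" "A \<in> \<A>" "B \<in> \<A>" "C \<in> \<A>" for A B C
  proof -
    have "measure M (sym_diff A C) \<le> measure M (sym_diff A B \<union> sym_diff B C)"
      using that sets by (intro finite_measure_mono) auto
    also have "\<dots> \<le> measure M (sym_diff A B) + measure M (sym_diff B C)"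
      using that sets by (intro measure_Un_le) auto
    finally have "\<kappa> * measure M (sym_diff A C) \<le>
        \<kappa> * measure M (sym_diff A B) + \<kappa> * measure M (sym_diff B C)"
      using pos by (simp flip: distrib_left)
    with that show ?thesis by (simp add: le_def)
  qed
  have step: "\<exists>B\<in>\<A>. le A B \<and> (\<forall>C\<in>\<A>. le A C \<longrightarrow> measure M C \<le> measure M B + 1 / real (Suc n))"
    if A: "A \<in> \<A>" for A n
  proof -
    define X where "X = measure M ` {B \<in> \<A>. le A B}"
    have X: "X \<noteq> {}" "bdd_above X"
      using A le_refl by (auto simp: X_def bdd_above_def intro: bounded_measure)
    have "Sup X - 1 / real (Suc n) < Sup X" by simp
    then obtain x where "x \<in> X" "Sup X - 1 / real (Suc n) < x"
      using less_cSup_iff[OF X] by blast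
    moreover have "measure M C \<le> Sup X" if "C \<in> \<A>" "le A C" for C
      using that X(2) by (intro cSup_upper) (auto simp: X_def)
    ultimately show ?thesis
      by (fastforce simp: X_def)
  qed
  obtain A0 where "A0 \<in> \<A>" using ne by blast
  have "\<exists>F. \<forall>n. F n \<in> \<A> \<and> (le (F n) (F (Suc n)) \<and>
      (\<forall>C\<in>\<A>. le (F n) C \<longrightarrow> measure M C \<le> measure M (F (Suc n)) + 1 / real (Suc n)))"
    by (rule dependent_nat_choice) (use \<open>A0 \<in> \<A>\<close> step in blast)+
  then obtain F where F: "\<And>n. F n \<in> \<A>" "\<And>n. le (F n) (F (Suc n))"
    and F_max: "\<And>n C. C \<in> \<A> \<Longrightarrow> le (F n) C \<Longrightarrow> measure M C \<le> measure M (F (Suc n)) + 1 / real (Suc n)"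
    by blast
  have F_sets: "F n \<in> sets M" for n using F(1) sets by blast
  define L where "L = (\<Union>n. \<Inter>k\<in>{n..}. F k)"
  have L: "L \<in> \<A>" unfolding L_def by (rule lim) (rule F(1))
  then have L_sets: "L \<in> sets M" using sets by blast
  define D where "D n = sym_diff (F n) (F (Suc n))" for n
  have D_sets: "D n \<in> sets M" for n using F_sets by (auto simp: D_def)
  have "incseq (\<lambda>n. measure M (F n))"
    using F(2) le_measure by (intro incseq_SucI) blast
  then obtain l where l: "(\<lambda>n. measure M (F n)) \<longlonglongrightarrow> l"
    using incseq_convergent[of "\<lambda>n. measure M (F n)" "measure M (space M)"] bounded_measure by blast
  have D_le: "\<kappa> * measure M (D n) \<le> measure M (F (Suc n)) - measure M (F n)" for n
    using F(2)[of n] by (simp add: le_def D_def)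
  have tele: "(\<lambda>i. measure M (F (Suc (i + n))) - measure M (F (i + n))) sums (l - measure M (F n))" for n
    using telescope_sums[OF LIMSEQ_ignore_initial_segment[OF l, of n]] by simp
  \<comment> \<open>The measures of the successive differences \<open>D\<close> are bounded by a
    telescoping series. Once \<open>l = measure M L\<close> is known, this estimate says that
    \<open>F n\<close> lies below \<open>L\<close> in the order.\<close>
  have tail: "\<kappa> * measure M (sym_diff (F n) L) \<le> l - measure M (F n)" for n
  proof -
    have summ: "summable (\<lambda>i. \<kappa> * measure M (D (i + n)))"
      by (rule summable_comparison_test'[OF sums_summable[OF tele[of n]], of 0])
         (use D_le pos in auto)
    then have summ': "summable (\<lambda>i. measure M (D (i + n)))" using pos by simp
    \<comment> \<open>A point outside all differences from time \<open>n\<close> on keeps its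
      membership, so its membership in the liminf is decided at time \<open>n\<close>.\<close>
    have const: "x \<in> F k \<longleftrightarrow> x \<in> F n" if "x \<notin> (\<Union>i. D (i + n))" "n \<le> k" for x k
      using that(2)
    proof (induction k rule: dec_induct)
      case (step k)
      have "x \<notin> D (k - n + n)" using that(1) by blast
      then show ?case using step by (auto simp: D_def)
    qed simp
    have "sym_diff (F n) L \<subseteq> (\<Union>i. D (i + n))"
    proof (rule ccontr)
      assume "\<not> ?thesis"
      then obtain x where x: "x \<in> sym_diff (F n) L" "x \<notin> (\<Union>i. D (i + n))" by blast
      have "x \<in> L \<longleftrightarrow> x \<in> F n"
      proof
        assume "x \<in> L"
        then obtain j where "\<forall>k\<ge>j. x \<in> F k" by (auto simp: L_def)
        then have "x \<in> F (max j n)" by simp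
        then show "x \<in> F n" using const[OF x(2) max.cobounded2] by blast
      next
        assume "x \<in> F n"
        then have "x \<in> F k" if "n \<le> k" for k using const[OF x(2) that] by blast
        then show "x \<in> L" unfolding L_def by blast
      qed
      with x(1) show False by blast
    qed
    then have "measure M (sym_diff (F n) L) \<le> measure M (\<Union>i. D (i + n))"
      using D_sets by (intro finite_measure_mono) auto
    also have "\<dots> \<le> (\<Sum>i. measure M (D (i + n)))"
      using D_sets summ' by (intro finite_measure_subadditive_countably) auto
    finally have "\<kappa> * measure M (sym_diff (F n) L) \<le> (\<Sum>i. \<kappa> * measure M (D (i + n)))"
      using pos summ' by (simp add: suminf_mult)
    also have "\<dots> \<le> (\<Sum>i. measure M (F (Suc (i + n))) - measure M (F (i + n)))"
      using D_le summ sums_summable[OF tele] by (intro suminf_le) auto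
    also have "\<dots> = l - measure M (F n)" using tele by (simp add: sums_iff)
    finally show ?thesis .
  qed
  have "l = measure M L"
  proof -
    have diff: "\<bar>measure M (F n) - measure M L\<bar> \<le> (l - measure M (F n)) / \<kappa>" for n
    proof -
      have "measure M B \<le> measure M C + measure M (sym_diff B C)" if "B \<in> sets M" "C \<in> sets M" for B C
      proof -
        have "measure M B \<le> measure M (C \<union> sym_diff B C)"
          using that by (intro finite_measure_mono) auto
        also have "\<dots> \<le> measure M C + measure M (sym_diff B C)"
          using that by (intro measure_Un_le) auto
        finally show ?thesis .
      qed
      from this[OF F_sets L_sets, of n] this[OF L_sets F_sets, of n]
      have "\<bar>measure M (F n) - measure M L\<bar> \<le> measure M (sym_diff (F n) L)"
        by (simp add: Un_commute)
      also have "\<dots> \<le> (l - measure M (F n)) / \<kappa>"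
        using tail[of n] pos by (simp add: field_simps)
      finally show ?thesis .
    qed
    have "(\<lambda>n. (l - measure M (F n)) / \<kappa>) \<longlonglongrightarrow> (l - l) / \<kappa>"
      by (rule tendsto_divide[OF tendsto_diff[OF tendsto_const l] tendsto_const]) (use pos in simp)
    then have "(\<lambda>n. (l - measure M (F n)) / \<kappa>) \<longlonglongrightarrow> 0" by simp
    then have "(\<lambda>n. measure M (F n) - measure M L) \<longlonglongrightarrow> 0"
      by (rule Lim_null_comparison[rotated]) (simp add: diff)
    then have "(\<lambda>n. measure M (F n)) \<longlonglongrightarrow> measure M L"
      by (simp add: LIM_zero_iff)
    then show ?thesis using l LIMSEQ_unique by blast
  qed
  then have FL: "le (F n) L" for n using tail by (simp add: le_def)
  show ?thesis
  proof (rule that[OF L])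
    fix B assume B: "B \<in> \<A>" and "\<kappa> * measure M (sym_diff L B) \<le> measure M B - measure M L"
    then have "le L B" by (simp add: le_def)
    \<comment> \<open>\<open>B\<close> lies above every \<open>F n\<close>, so the near-maximality
      of each \<open>F (Suc n)\<close> bounds its measure, with an error tending to 0.\<close>
    then have "le (F n) B" for n using le_trans FL F(1) L B by blast
    then have "measure M B \<le> measure M L + 1 / real (Suc n)" for n
      using F_max[OF B, of n] le_measure[OF FL[of "Suc n"]] by fastforce
    moreover have "(\<lambda>n. measure M L + 1 / real (Suc n)) \<longlonglongrightarrow> measure M L"
      using tendsto_add[OF tendsto_const LIMSEQ_inverse_real_of_nat]
      by (simp add: inverse_eq_divide)
    ultimately show "measure M B \<le> measure M L"
      by (intro LIMSEQ_le_const) auto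
  qed
qed

section \<open>Overwriting an admissible set on a tower\<close>

lemma admissible_forI:
  assumes "A \<in> sets M"
    and "\<And>u v x y. {u, v} \<in> E \<Longrightarrow> x \<in> A \<Longrightarrow> y \<in> A \<Longrightarrow> f u x \<noteq> f v y"
  shows "admissible_for E M f A"
  using assms unfolding admissible_for_def by blast

text \<open>\<open>A\<close> is erased on the whole tower \<open>W\<close> and the pattern is
  written on inner levels. Conflicts of a new point with an old one are excluded by the margins,
  conflicts between two new points by the disjointness of the levels and the separation of
  \<open>S\<close>.\<close>

lemma admissible_for_replace:
  fixes f :: "nat ^ 'd \<Rightarrow> 'a \<Rightarrow> 'a"
  assumes "prob_space M" and f: "mp_action M f" and A: "admissible_for E M f A"
    and S: "S \<subseteq> nat_box N" "sum_separated E S" and E: "\<forall>e\<in>E. \<forall>u\<in>e. all_less u m"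
    and C: "tower_base (nat_box (N + (m + m))) M f C"
  defines "W \<equiv> \<Union>k\<in>nat_box (N + (m + m)). f k -` C \<inter> space M"
  obtains B where "admissible_for E M f B"
    "measure M B = measure M A - measure M (A \<inter> W) + real (card S) * measure M C"
    "sym_diff A B \<subseteq> W"
proof -
  interpret prob_space M by fact
  \<comment> \<open>The pattern is reflected, since \<open>f u\<close> lowers the level by
    \<open>u\<close>: the equation \<open>p s - u = p t - v\<close> then becomes
    \<open>s + u = t + v\<close>. On \<open>S\<close> the coordinates of \<open>p s\<close> range
    from \<open>m $ i\<close> to \<open>N $ i + m $ i - 1\<close>.\<close>
  define p :: "nat ^ 'd \<Rightarrow> nat ^ 'd" where "p s = (\<chi> i. N $ i + m $ i - Suc (s $ i))" for s
  define G where "G k = f k -` C \<inter> space M" for k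
  define B where "B = (A - W) \<union> (\<Union>s\<in>S. G (p s))"
  have A_sets: "A \<in> sets M" and A_adm: "\<And>u v. {u, v} \<in> E \<Longrightarrow> f u ` A \<inter> f v ` A = {}"
    using A by (auto simp: admissible_for_def)
  have C_sets: "C \<in> sets M" and G_disj: "disjoint_family_on G (nat_box (N + (m + m)))"
    using C unfolding tower_base_def G_def by blast+
  have W: "W = (\<Union>k\<in>nat_box (N + (m + m)). G k)" by (simp add: W_def G_def)
  have G: "G k \<in> sets M" "measure M (G k) = measure M C" for k
    using C_sets f by (simp_all add: G_def mp_action_vimage_sets mp_action_measure_vimage)
  have W_sets: "W \<in> sets M" unfolding W using G finite_nat_box by (intro sets.finite_UN) auto
  have less: "s $ i < N $ i" if "s \<in> S" for s i using that S(1) by (auto simp: mem_nat_box)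
  have p_box: "p s \<in> nat_box (N + (m + m))" if "s \<in> S" for s
  proof -
    have "N $ i + m $ i - Suc (s $ i) < N $ i + (m $ i + m $ i)" for i
      using less[OF that, of i] by linarith
    then show ?thesis by (simp add: mem_nat_box p_def)
  qed
  have p_inj: "inj_on p S"
  proof (rule inj_onI)
    fix s t assume st: "s \<in> S" "t \<in> S" "p s = p t"
    have "s $ i = t $ i" for i
    proof -
      have "N $ i + m $ i - Suc (s $ i) = N $ i + m $ i - Suc (t $ i)"
        using st(3) by (simp add: p_def vec_eq_iff)
      with less[OF st(1), of i] less[OF st(2), of i] show ?thesis by linarith
    qed
    then show "s = t" by (simp add: vec_eq_iff)
  qed
  \<comment> \<open>The levels \<open>p s\<close> keep a distance of at least \<open>m\<close> from both ends of the tower, so moving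
    them along an edge of \<open>E\<close> does not leave the tower.\<close>
  have p_shift: "p s - u \<in> nat_box (N + (m + m))" "p s - u + v \<in> nat_box (N + (m + m))"
      "p s - u + u = p s"
    if s: "s \<in> S" and uv: "{u, v} \<in> E" for s u v
  proof -
    have *: "u $ i < m $ i" "v $ i < m $ i" for i
      using E uv by (auto simp: all_less_def)
    have "p s $ i - u $ i < N $ i + (m $ i + m $ i)" "p s $ i - u $ i + v $ i < N $ i + (m $ i + m $ i)"
      "p s $ i - u $ i + u $ i = p s $ i" for i
      using *[of i] less[OF s, of i] unfolding p_def vec_lambda_beta by linarith+
    then show "p s - u \<in> nat_box (N + (m + m))" "p s - u + v \<in> nat_box (N + (m + m))"
      "p s - u + u = p s"
      by (auto simp: mem_nat_box vec_eq_iff)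
  qed
  have hit: "f (p s - u) (f u x) \<in> C" if "s \<in> S" "{u, v} \<in> E" "x \<in> G (p s)" for s u v x
    using that p_shift(3)[OF that(1,2)] by (simp add: G_def mp_action_add[OF f])
  \<comment> \<open>The common image lies on level \<open>p s - u\<close>, so \<open>x\<close> lies
    on level \<open>p s - u + v\<close>, still inside the tower.\<close>
  have old_new: False if "{u, v} \<in> E" "x \<in> A - W" "s \<in> S" "y \<in> G (p s)" "f v x = f u y" for u v x y s
  proof -
    have x: "x \<in> space M" using that(2) sets.sets_into_space[OF A_sets] by blast
    have "f (p s - u) (f v x) \<in> C" using hit[OF that(3,1,4)] that(5) by simp
    then have "x \<in> G (p s - u + v)" using x by (simp add: G_def mp_action_add[OF f x])
    with p_shift(2)[OF that(3,1)] have "x \<in> W" by (auto simp: W)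
    with that(2) show False by blast
  qed
  \<comment> \<open>The common image lies on the levels \<open>p s - u\<close> and
    \<open>p t - v\<close>, which therefore coincide.\<close>
  have new_new: False if uv: "{u, v} \<in> E" and "s \<in> S" "x \<in> G (p s)" "t \<in> S" "y \<in> G (p t)"
    and eq: "f u x = f v y" for u v x y s t
  proof -
    have vu: "{v, u} \<in> E" using uv by (simp add: insert_commute)
    have "f (p s - u) (f u x) \<in> C" "f (p t - v) (f u x) \<in> C"
      using hit[OF _ uv, of s x] hit[OF _ vu, of t y] that by auto
    moreover have "f u x \<in> space M" using that(3) mp_action_space[OF f] by (auto simp: G_def)
    ultimately have "f u x \<in> G (p s - u)" "f u x \<in> G (p t - v)" by (auto simp: G_def)
    with G_disj p_shift(1)[OF that(2) uv] p_shift(1)[OF that(4) vu]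
    have same: "p s - u = p t - v" by (auto simp: disjoint_family_on_def)
    have "s $ i + u $ i = t $ i + v $ i" for i
    proof -
      have "p s $ i - u $ i = p t $ i - v $ i" using same by (simp add: vec_eq_iff)
      moreover have "u $ i < m $ i" "v $ i < m $ i"
        using E uv by (auto simp: all_less_def)
      ultimately show ?thesis
        using less[OF that(2), of i] less[OF that(4), of i]
        unfolding p_def vec_lambda_beta by linarith
    qed
    then have "s + u = t + v" by (simp add: vec_eq_iff)
    with S(2) uv that show False by (auto simp: sum_separated_def)
  qed
  have disj: "f u x \<noteq> f v y" if uv: "{u, v} \<in> E" and xy: "x \<in> B" "y \<in> B" for u v x y
  proof
    assume eq: "f u x = f v y"
    have vu: "{v, u} \<in> E" using uv by (simp add: insert_commute)
    from xy consider "x \<in> A - W" "y \<in> A - W"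
      | s where "x \<in> A - W" "s \<in> S" "y \<in> G (p s)"
      | s where "y \<in> A - W" "s \<in> S" "x \<in> G (p s)"
      | s t where "s \<in> S" "x \<in> G (p s)" "t \<in> S" "y \<in> G (p t)"
      unfolding B_def by blast
    then show False
    proof cases
      case 1
      then show ?thesis using A_adm[OF uv] eq by blast
    next
      case 2
      then show ?thesis using old_new[OF vu] eq by blast
    next
      case 3
      then show ?thesis using old_new[OF uv] eq by metis
    next
      case 4
      then show ?thesis using new_new[OF uv] eq by blast
    qed
  qed
  have "finite S" using S(1) finite_nat_box by (rule finite_subset)
  then have U_sets: "(\<Union>s\<in>S. G (p s)) \<in> sets M" using G by (intro sets.finite_UN) auto
  then have "B \<in> sets M" using A_sets W_sets by (auto simp: B_def)
  then have adm: "admissible_for E M f B" using disj by (rule admissible_forI)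
  have UW: "(\<Union>s\<in>S. G (p s)) \<subseteq> W" using p_box by (auto simp: W)
  have "measure M (\<Union>s\<in>S. G (p s)) = (\<Sum>s\<in>S. measure M (G (p s)))"
  proof (rule finite_measure_finite_Union)
    show "disjoint_family_on (\<lambda>s. G (p s)) S"
      using G_disj p_box inj_onD[OF p_inj] unfolding disjoint_family_on_def by metis
  qed (use \<open>finite S\<close> G in auto)
  then have U: "measure M (\<Union>s\<in>S. G (p s)) = real (card S) * measure M C" by (simp add: G)
  have "measure M B = measure M (A - W) + measure M (\<Union>s\<in>S. G (p s))"
    unfolding B_def using A_sets W_sets U_sets UW by (intro finite_measure_Union) auto
  also have "measure M (A - W) = measure M A - measure M (A \<inter> W)"
    using A_sets W_sets by (rule finite_measure_Diff')
  finally have meas: "measure M B = measure M A - measure M (A \<inter> W) + real (card S) * measure M C"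
    using U by simp
  have "sym_diff A B \<subseteq> W" using UW by (auto simp: B_def)
  with adm meas show ?thesis by (rule that)
qed

section \<open>Lower bound by sets that cannot be improved\<close>

lemma bdd_above_measure_admissible:
  "prob_space M \<Longrightarrow> bdd_above (measure M ` {A. admissible_for E M f A})"
  by (rule bdd_aboveI[of _ 1]) (auto simp: prob_space.prob_le_1)

text \<open>A set that cannot be improved at rate \<open>\<kappa>\<close> has measure at least
  \<open>card S / q - \<kappa>\<close>: otherwise overwriting it on a tower that meets it no more
  than on average would improve it at a higher rate.\<close>

lemma d_graph_ge_pattern_density:
  fixes f :: "nat ^ 'd \<Rightarrow> 'a \<Rightarrow> 'a"
  assumes M: "standard_prob_space M" and f: "mp_action M f" "free_action M f"
    and S: "S \<subseteq> nat_box N" "sum_separated E S" and E: "\<forall>e\<in>E. \<forall>u\<in>e. all_less u m"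
    and N: "\<forall>i. 0 < N $ i"
  shows "real (card S) / real (vec_prod (N + (m + m))) \<le> d_graph E M f"
proof -
  interpret prob_space M using M by (simp add: standard_prob_space_def)
  define R where "R = nat_box (N + (m + m))"
  define q where "q = real (vec_prod (N + (m + m)))"
  have R: "finite R" "real (card R) = q" by (simp_all add: R_def q_def finite_nat_box card_nat_box)
  have q: "0 < q" using vec_prod_pos[of "N + (m + m)"] N by (simp add: q_def)
  have "real (card S) / q \<le> d_graph E M f + \<kappa>" if \<kappa>: "0 < \<kappa>" for \<kappa>
  proof -
    obtain A where A: "admissible_for E M f A"
      and max: "\<And>B. admissible_for E M f B \<Longrightarrow>
        \<kappa> * measure M (sym_diff A B) \<le> measure M B - measure M A \<Longrightarrow> measure M B \<le> measure M A"
    proof (rule ekeland_sets[of "{A. admissible_for E M f A}" \<kappa>])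
      show "{A. admissible_for E M f A} \<subseteq> sets M" by (auto simp: admissible_for_def)
      have "admissible_for E M f {}" by (simp add: admissible_for_def)
      then show "{A. admissible_for E M f A} \<noteq> {}" by blast
      fix F :: "nat \<Rightarrow> 'a set" assume F: "\<And>n. F n \<in> {A. admissible_for E M f A}"
      \<comment> \<open>Two points of the liminf lie in a common set \<open>F (max i j)\<close>, so
        admissibility passes to the liminf.\<close>
      have disj: "f u x \<noteq> f v y" if "{u, v} \<in> E" "x \<in> (\<Inter>k\<in>{i..}. F k)" "y \<in> (\<Inter>k\<in>{j..}. F k)"
        for u v x y and i j :: nat
      proof -
        have "x \<in> F (max i j)" "y \<in> F (max i j)" using that by auto
        then show ?thesis using F[of "max i j"] that(1) by (auto simp: admissible_for_def)
      qed
      have lim_sets: "(\<Union>n. \<Inter>k\<in>{n..}. F k) \<in> sets M"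
      proof -
        have "F k \<in> sets M" for k using F[of k] by (simp add: admissible_for_def)
        then have "(\<Inter>k\<in>{n..}. F k) \<in> sets M" for n
          by (intro sets.countable_INT') auto
        then show ?thesis by (intro sets.countable_UN) blast
      qed
      have "admissible_for E M f (\<Union>n. \<Inter>k\<in>{n..}. F k)"
      proof (rule admissible_forI[OF lim_sets])
        fix u v x y
        assume uv: "{u, v} \<in> E" and "x \<in> (\<Union>n. \<Inter>k\<in>{n..}. F k)" "y \<in> (\<Union>n. \<Inter>k\<in>{n..}. F k)"
        then obtain i j where "x \<in> (\<Inter>k\<in>{i..}. F k)" "y \<in> (\<Inter>k\<in>{j..}. F k)"
          unfolding UN_iff by (elim bexE)
        then show "f u x \<noteq> f v y" by (rule disj[OF uv])
      qed
      then show "(\<Union>n. \<Inter>k\<in>{n..}. F k) \<in> {A. admissible_for E M f A}" by simp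
    qed (use \<kappa> in auto)
    have A_sets: "A \<in> sets M" using A by (simp add: admissible_for_def)
    have "real (card S) / q \<le> measure M A + \<kappa>"
    proof (rule ccontr)
      assume "\<not> ?thesis"
      then have small: "q * measure M A + \<kappa> * q < real (card S)"
        using q by (simp add: field_simps)
      have "\<forall>i. k $ i \<le> (N + (m + m)) $ i" if "k \<in> R" for k
        using that by (auto simp: R_def mem_nat_box less_imp_le)
      then obtain C where C: "tower_base R M f C" "0 < measure M C"
        and avg: "(\<Sum>k\<in>R. measure M (A \<inter> (f k -` C \<inter> space M))) \<le> q * measure M A * measure M C"
        using exists_tower_base_le_average[OF M f R(1) _ A_sets] R(2) by metis
      define W where "W = (\<Union>k\<in>R. f k -` C \<inter> space M)"
      obtain B where B: "admissible_for E M f B"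
        "measure M B = measure M A - measure M (A \<inter> W) + real (card S) * measure M C"
        "sym_diff A B \<subseteq> W"
        using admissible_for_replace[OF prob_space_axioms f(1) A S E C(1)[unfolded R_def]]
        unfolding W_def R_def by blast
      have G: "f k -` C \<inter> space M \<in> sets M" "measure M (f k -` C \<inter> space M) = measure M C" for k
        using C(1) f by (simp_all add: tower_base_def mp_action_vimage_sets mp_action_measure_vimage)
      have W_sets: "W \<in> sets M" unfolding W_def using G R(1) by (intro sets.finite_UN) auto
      have "measure M (A \<inter> W) = measure M (\<Union>k\<in>R. A \<inter> (f k -` C \<inter> space M))"
        by (simp add: W_def Int_UN_distrib)
      also have "\<dots> \<le> (\<Sum>k\<in>R. measure M (A \<inter> (f k -` C \<inter> space M)))"
        using R(1) A_sets G by (intro finite_measure_subadditive_finite) auto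
      finally have AW: "measure M (A \<inter> W) \<le> q * measure M A * measure M C" using avg by simp
      \<comment> \<open>The change is confined to \<open>q\<close> levels of measure
        \<open>measure M C\<close>, while the gain is at least
        \<open>card S - q * measure M A\<close> times that measure. Strictness uses that
        \<open>C\<close> has positive measure.\<close>
      have "measure M (sym_diff A B) \<le> measure M W"
        using B(3) W_sets by (rule finite_measure_mono)
      also have "\<dots> \<le> (\<Sum>k\<in>R. measure M (f k -` C \<inter> space M))"
        unfolding W_def using R(1) G by (intro finite_measure_subadditive_finite) auto
      also have "\<dots> = q * measure M C" using G R(2) by simp
      finally have "\<kappa> * measure M (sym_diff A B) \<le> \<kappa> * q * measure M C"
        using \<kappa> by simp
      also have "\<dots> < (real (card S) - q * measure M A) * measure M C"
        using small C(2) by (intro mult_strict_right_mono) auto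
      also have "\<dots> \<le> measure M B - measure M A"
        using B(2) AW by (simp add: algebra_simps)
      finally have gain: "\<kappa> * measure M (sym_diff A B) < measure M B - measure M A" .
      then have "measure M B \<le> measure M A" using max[OF B(1)] by simp
      moreover have "0 \<le> \<kappa> * measure M (sym_diff A B)" using \<kappa> by simp
      ultimately show False using gain by simp
    qed
    also have "measure M A \<le> d_graph E M f"
      unfolding d_graph_def using A bdd_above_measure_admissible[OF prob_space_axioms]
      by (intro cSUP_upper) auto
    finally show ?thesis by simp
  qed
  then show ?thesis unfolding q_def by (rule field_le_epsilon)
qed

theorem proposition3p6:
  fixes V :: "(nat ^ 'd) set" and E :: "(nat ^ 'd) set set"
    and m N :: "nat ^ 'd"
    and M :: "'a measure" and f :: "nat ^ 'd \<Rightarrow> 'a \<Rightarrow> 'a"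
  assumes "finite V" and "simple_graph V E"
    and "\<forall>i. 0 < m $ i" and "\<forall>v\<in>V. all_less v m"
    and "\<forall>i. 0 < N $ i"
    and "standard_prob_space M" and "atomless M"
    and "mp_action M f" and "free_action M f"
  shows "real (vec_prod N) / real (vec_prod (N + m)) * M_graph E N \<le> d_graph E M f \<and>
         d_graph E M f \<le> M_graph E N + (\<Sum>i\<in>UNIV. 1 / real (N $ i))"
proof
  have prob: "prob_space M" using assms(6) by (simp add: standard_prob_space_def)
  have E: "\<forall>e\<in>E. \<forall>u\<in>e. all_less u m"
    using assms(2,4) by (fastforce simp: simple_graph_def)
  obtain S where S: "S \<subseteq> nat_box N" "sum_separated E S"
    and card: "M_graph E N = real (card S) / real (vec_prod N)"
    by (rule M_graph_attained)
  define L where "L = N + m"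
  have L: "\<forall>i. 0 < L $ i" and SL: "S \<subseteq> nat_box L"
    using assms(5) S(1) by (auto simp: L_def mem_nat_box trans_less_add1)
  \<comment> \<open>All \<open>K ^ CARD('d)\<close> copies form a single pattern, so the tower
    margin \<open>m + m\<close> is paid once and vanishes in the limit. For \<open>1 \<le> K\<close>
    the box of this pattern has positive sides.\<close>
  have "real (K ^ CARD('d)) / real (vec_prod ((\<chi> i. K) * L + (m + m))) * real (card S) \<le> d_graph E M f"
    if "1 \<le> K" for K
    using d_graph_ge_pattern_density[OF assms(6,8,9) tile_subset[OF SL, of K]
        sum_separated_tile[OF S E, folded L_def, where K = K] E] that L
    by (simp add: card_tile[OF SL])
  moreover have "(\<lambda>K. real (K ^ CARD('d)) / real (vec_prod ((\<chi> i. K) * L + (m + m))) * real (card S))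
      \<longlonglongrightarrow> 1 / real (vec_prod L) * real (card S)"
    by (intro tendsto_intros tile_density_tendsto L)
  ultimately have "1 / real (vec_prod L) * real (card S) \<le> d_graph E M f"
    by (intro LIMSEQ_le_const2) auto
  then show "real (vec_prod N) / real (vec_prod (N + m)) * M_graph E N \<le> d_graph E M f"
    using vec_prod_pos[OF assms(5)] by (simp add: card L_def)
  have "admissible_for E M f {}" by (simp add: admissible_for_def)
  then have "d_graph E M f \<le> M_graph E N"
    unfolding d_graph_def using measure_admissible_le_M_graph[OF prob assms(8) _ assms(5)]
    by (intro cSUP_least) auto
  \<comment> \<open>Adding the nonnegative error sum weakens the counting bound to the stated
    one.\<close>
  moreover have "0 \<le> (\<Sum>i\<in>UNIV. 1 / real (N $ i))" by (intro sum_nonneg) auto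
  ultimately show "d_graph E M f \<le> M_graph E N + (\<Sum>i\<in>UNIV. 1 / real (N $ i))" by simp
qed

end
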